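(* Let $\mathcal{P}_{2,\mathrm{sym}}$ be the class of all $P\in\mathcal{P}_2$ that are symmetric around the mean. Set $L_*=4\sqrt{2(1+2\ln 2)(1+62\ln 3)}\,e^{5/2}$ and $\delta_{\min,n,1}=4e^{3-n/124}$. 1. For every integer $n\ge(3+\ln 4)\,124$ there exists a measurable map $\widehat{E}_n:\mathbb{R}^n\to\mathbb{R}$ which is a multiple-$\delta$ $L_*$-sub-Gaussian estimator for $(\mathcal{P}_{2,1\text{-reg}},n,\delta_{\min,n,1})$ and which is also a multiple-$\delta$ $L_*$-sub-Gaussian estimator for $(\mathcal{P}_{2,\mathrm{sym}},n,\delta_{\min,n,1})$. 2. On the other hand, for any $L\ge\sqrt{2}$, no $\delta$-dependent $L$-sub-Gaussian estimator can exist for $(\mathcal{P}_{2,\mathrm{sym}},n,e^{1-5L^2n})$.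
   Context: $\mathcal{P}_2$ is the class of all probability distributions on $\mathbb{R}$ with finite second moment; $\mu_P,\sigma_P^2$ denote the mean and variance of $P\in\mathcal{P}_2$. $P\in\mathcal{P}_2$ is symmetric around the mean if, when $X$ has distribution $P$, $2\mu_P-X$ also has distribution $P$. For $P\in\mathcal{P}_2$ and a positive integer $j$, with $X_1,\dots,X_j$ i.i.d. from $P$, let $p_-(P,j)=\mathbb{P}\left(\sum_{i=1}^jX_i\le j\mu_P\right)$ and $p_+(P,j)=\mathbb{P}\left(\sum_{i=1}^jX_i\ge j\mu_P\right)$; $\mathcal{P}_{2,1\text{-reg}}=\{P\in\mathcal{P}_2:\ \forall j\ge 1,\ \min(p_+(P,j),p_-(P,j))\ge 1/3\}$. Let $n$ be a positive integer, $L>0$, $\delta_{\min}\in(0,1)$, $\mathcal{P}\subset\mathcal{P}_2$. A $\delta$-dependent $L$-sub-Gaussian estimator for $(\mathcal{P},n,\delta_{\min})$ is a measurable map $\widehat{E}_n:\mathbb{R}^n\times[\delta_{\min},1)\to\mathbb{R}$ such that for all $P\in\mathcal{P}$ and $\delta\in[\delta_{\min},1)$, if $X_1^n$ is an i.i.d. sample of size $n$ from $P$, then $\mathbb{P}\left(|\widehat{E}_n(X_1^n,\delta)-\mu_P|>L\,\sigma_P\sqrt{\frac{1+\ln(1/\delta)}{n}}\right)\le\delta$. A multiple-$\delta$ $L$-sub-Gaussian estimator for $(\mathcal{P},n,\delta_{\min})$ is a measurable map $\widehat{E}_n:\mathbb{R}^n\to\mathbb{R}$ (not depending on $\delta$)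 such that for all $\delta\in[\delta_{\min},1)$, $P\in\mathcal{P}$ and i.i.d. samples $X_1^n$ from $P$, $\mathbb{P}\left(|\widehat{E}_n(X_1^n)-\mu_P|>L\,\sigma_P\sqrt{\frac{1+\ln(1/\delta)}{n}}\right)\le\delta$. *)

theory Defs
  imports "HOL-Probability.Probability"
begin

text \<open>Probability distributions on the real line are Borel probability measures, i.e. measures
  satisfying \<^locale>\<open>real_distribution\<close>.\<close>

definition P2 :: "real measure set" where
  "P2 = {P. real_distribution P \<and> integrable P (\<lambda>x. x\<^sup>2)}"

definition mean :: "real measure \<Rightarrow> real" where
  "mean P = (\<integral>x. x \<partial>P)"

definition std_dev :: "real measure \<Rightarrow> real" where
  "std_dev P = sqrt (\<integral>x. (x - mean P)\<^sup>2 \<partial>P)"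

definition symmetric_around_mean :: "real measure \<Rightarrow> bool" where
  "symmetric_around_mean P \<longleftrightarrow> distr P borel (\<lambda>x. 2 * mean P - x) = P"

definition P2_sym :: "real measure set" where
  "P2_sym = {P \<in> P2. symmetric_around_mean P}"

text \<open>The joint law of an i.i.d. sample of size \<open>n\<close> from \<open>P\<close>, with coordinates indexed by
  \<open>0, \<dots>, n - 1\<close>. Every i.i.d. sample on any probability space has this law
  (\<open>prob_space.indep_vars_iff_distr_eq_PiM\<close>), so probabilities of events about the sample are
  computed here.\<close>

definition iid_sample :: "nat \<Rightarrow> real measure \<Rightarrow> (nat \<Rightarrow> real) measure" where
  "iid_sample n P = (\<Pi>\<^sub>M i\<in>{..<n}. P)"

text \<open>The Borel space \<open>\<real>\<^sup>n\<close>, on the same carrier of functions on \<open>{..<n}\<close>.\<close>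

definition real_space :: "nat \<Rightarrow> (nat \<Rightarrow> real) measure" where
  "real_space n = (\<Pi>\<^sub>M i\<in>{..<n}. borel)"

definition p_minus :: "real measure \<Rightarrow> nat \<Rightarrow> real" where
  "p_minus P j = \<P>(x in iid_sample j P. (\<Sum>i<j. x i) \<le> real j * mean P)"

definition p_plus :: "real measure \<Rightarrow> nat \<Rightarrow> real" where
  "p_plus P j = \<P>(x in iid_sample j P. (\<Sum>i<j. x i) \<ge> real j * mean P)"

definition P2_1reg :: "real measure set" where
  "P2_1reg = {P \<in> P2. \<forall>j\<ge>1. min (p_plus P j) (p_minus P j) \<ge> 1 / 3}"

text \<open>The standing conditions \<open>n \<ge> 1\<close>, \<open>L > 0\<close>, \<open>\<delta>\<^sub>m\<^sub>i\<^sub>n \<in> (0, 1)\<close> and \<open>\<C> \<subseteq> P2\<close> are not part of the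
  following two predicates; they concern the parameters only.\<close>

definition delta_dependent_subgaussian ::
    "real \<Rightarrow> real measure set \<Rightarrow> nat \<Rightarrow> real \<Rightarrow> ((nat \<Rightarrow> real) \<times> real \<Rightarrow> real) \<Rightarrow> bool" where
  "delta_dependent_subgaussian L \<C> n \<delta>min E \<longleftrightarrow>
     E \<in> borel_measurable (real_space n \<Otimes>\<^sub>M restrict_space borel {\<delta>min..<1}) \<and>
     (\<forall>P\<in>\<C>. \<forall>\<delta>\<in>{\<delta>min..<1}.
        \<P>(x in iid_sample n P.
            \<bar>E (x, \<delta>) - mean P\<bar> > L * std_dev P * sqrt ((1 + ln (1 / \<delta>)) / real n)) \<le> \<delta>)"

definition multiple_delta_subgaussian ::
    "real \<Rightarrow> real measure set \<Rightarrow> nat \<Rightarrow> real \<Rightarrow> ((nat \<Rightarrow> real) \<Rightarrow> real) \<Rightarrow> bool" where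
  "multiple_delta_subgaussian L \<C> n \<delta>min E \<longleftrightarrow>
     E \<in> borel_measurable (real_space n) \<and>
     (\<forall>\<delta>\<in>{\<delta>min..<1}. \<forall>P\<in>\<C>.
        \<P>(x in iid_sample n P.
            \<bar>E x - mean P\<bar> > L * std_dev P * sqrt ((1 + ln (1 / \<delta>)) / real n)) \<le> \<delta>)"

definition L_star :: real where
  "L_star = 4 * sqrt (2 * (1 + 2 * ln 2) * (1 + 62 * ln 3)) * exp (5 / 2)"

definition delta_min1 :: "nat \<Rightarrow> real" where
  "delta_min1 n = 4 * exp (3 - real n / 124)"

end

theory Submission
  imports Defs
begin

text \<open>
  \<^bold>\<open>The estimator.\<close> For each \<open>b \<le> n\<close> cut the sample into \<open>b\<close> blocks and let \<open>I\<^sub>b\<close> be the interval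
  between the \<open>\<lceil>b/6\<rceil>\<close>-th smallest and the \<open>\<lceil>b/6\<rceil>\<close>-th largest of the block means. Start from an
  arbitrary point and clamp it successively into \<open>I\<^sub>1, I\<^sub>2, \<dots>, I\<^sub>n\<close>; the result is the estimate. It
  involves no confidence level.

  \<^bold>\<open>Why it is sub-Gaussian at all levels at once.\<close> Each block mean lies on either side of \<open>\<mu>\<close> with
  probability at least \<open>1/3\<close>, which exceeds \<open>1/6\<close>, so by Hoeffding \<open>I\<^sub>b\<close> misses \<open>\<mu>\<close> with probability at
  most \<open>2 exp (- b/18)\<close>. By Chebyshev, a block mean is more than six of its standard deviations
  away from \<open>\<mu>\<close> with probability at most \<open>1/36\<close>, which is below \<open>1/6\<close>, so by Hoeffding again \<open>I\<^sub>b\<close>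
  sticks out of the corresponding neighbourhood of \<open>\<mu>\<close> with probability at most \<open>exp (- b/26)\<close>.
  Given \<open>\<delta>\<close>, choose \<open>b\<^sub>0\<close> of order \<open>1 + ln (1/\<delta>)\<close> such that the probabilities that \<open>I\<^sub>b\<close> misses \<open>\<mu>\<close> for
  some \<open>b \<ge> b\<^sub>0\<close>, or that \<open>I\<close> is too long at \<open>b\<^sub>0\<close>, sum to at most \<open>\<delta>\<close>. Outside these events, clamping
  into \<open>I\<close> at \<open>b\<^sub>0\<close> puts the point within \<open>6 \<sigma> / sqrt (n div b\<^sub>0)\<close> of \<open>\<mu>\<close>, and every later clamp
  projects onto an interval that contains \<open>\<mu>\<close>, which cannot increase the distance to \<open>\<mu>\<close>
  (\<open>estimator_close\<close>). Since \<open>n div b\<^sub>0 \<ge> n / (2 b\<^sub>0)\<close>, this distance has the required order. The level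
  enters only through the analysis, hence \<open>estimator_subgaussian\<close>. A distribution that is
  symmetric around its mean has \<open>p\<^sub>+ = p\<^sub>- \<ge> 1/2\<close>, so it is covered as well.

  \<^bold>\<open>Why extremely small \<open>\<delta>\<close> are impossible.\<close> Put mass \<open>p/2\<close> on each of \<open>c - 1\<close> and \<open>c + 1\<close> and the
  rest on \<open>c\<close>, with \<open>p = 1 / (6 L\<^sup>4)\<close>. The laws for \<open>c = 0\<close> and \<open>c = 2\<close> share the atom \<open>1\<close>, so the sample
  \<open>(1, \<dots>, 1)\<close> has probability at least \<open>(p/2)\<^sup>n\<close> under both. At \<open>\<delta> = exp (1 - 5 L\<^sup>2 n)\<close> the permitted
  radius is \<open>sqrt (5/6) < 1\<close>, so on this sample the estimate errs for one of the two laws, although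
  \<open>(p/2)\<^sup>n > \<delta>\<close>.
\<close>

section \<open>Independent samples\<close>

lemma sets_iid_sample:
  assumes "real_distribution P"
  shows "sets (iid_sample n P) = sets (real_space n)"
  unfolding iid_sample_def real_space_def
  by (intro sets_PiM_cong refl) (use assms in \<open>auto simp: real_distribution.events_eq_borel\<close>)

lemma space_iid_sample:
  assumes "real_distribution P"
  shows "space (iid_sample n P) = space (real_space n)"
  using sets_iid_sample[OF assms] by (rule sets_eq_imp_space_eq)

lemma measurable_iid_sample:
  assumes "real_distribution P" "f \<in> measurable (real_space n) N"
  shows "f \<in> measurable (iid_sample n P) N"
  using assms(2) measurable_cong_sets[OF sets_iid_sample[OF assms(1)] refl] by blast

lemma measurable_coordinate [measurable]:
  "i < n \<Longrightarrow> (\<lambda>x. x i) \<in> borel_measurable (real_space n)"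
  unfolding real_space_def by (rule measurable_component_singleton) simp

lemma prob_space_iid_sample:
  assumes "real_distribution P"
  shows "prob_space (iid_sample n P)"
  unfolding iid_sample_def
  by (intro prob_space_PiM) (use assms in \<open>simp add: real_distribution_def\<close>)

lemma distr_subsample:
  assumes P: "real_distribution P" and f: "inj_on f {..<m}" "f \<in> {..<m} \<rightarrow> {..<n}"
  shows "distr (iid_sample n P) (iid_sample m P) (\<lambda>x. \<lambda>i\<in>{..<m}. x (f i)) = iid_sample m P"
  unfolding iid_sample_def
  by (rule distr_PiM_reindex) (use P f in \<open>auto simp: real_distribution_def\<close>)

lemma distr_coordinate:
  assumes P: "real_distribution P" and "i < n"
  shows "distr (iid_sample n P) borel (\<lambda>x. x i) = P"
proof -
  have "distr (iid_sample n P) borel (\<lambda>x. x i) = distr (iid_sample n P) P (\<lambda>x. x i)"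
    by (intro distr_cong) (simp_all add: real_distribution.events_eq_borel[OF P])
  also have "\<dots> = P"
    unfolding iid_sample_def
    by (rule distr_PiM_component) (use P assms(2) in \<open>auto simp: real_distribution_def\<close>)
  finally show ?thesis .
qed

text \<open>The identity has the product of its marginals as its law.\<close>
lemma indep_vars_coordinates:
  assumes P: "real_distribution P" and "n > 0"
  shows "prob_space.indep_vars (iid_sample n P) (\<lambda>_. borel) (\<lambda>i x. x i) {..<n}"
proof -
  interpret prob_space "iid_sample n P" by (rule prob_space_iid_sample[OF P])
  have "distr (iid_sample n P) (\<Pi>\<^sub>M i\<in>{..<n}. borel) (\<lambda>x. \<lambda>i\<in>{..<n}. x i) =
        distr (iid_sample n P) (iid_sample n P) (\<lambda>x. x)"
    by (intro distr_cong)
       (auto simp: sets_iid_sample[OF P] real_space_def space_iid_sample[OF P] space_PiM)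
  also have "\<dots> = (\<Pi>\<^sub>M i\<in>{..<n}. distr (iid_sample n P) borel (\<lambda>x. x i))"
    unfolding distr_id by (auto simp: iid_sample_def intro!: PiM_cong distr_coordinate[OF P, unfolded iid_sample_def, symmetric])
  finally show ?thesis
    using \<open>n > 0\<close>
    by (subst indep_vars_iff_distr_eq_PiM') (auto intro!: measurable_iid_sample[OF P])
qed

lemma integral_coordinate:
  assumes P: "real_distribution P" and "i < n" and f: "f \<in> borel_measurable borel"
  shows "(\<integral>x. f (x i) \<partial>iid_sample n P) = ((\<integral>y. f y \<partial>P) :: real)"
    and "integrable (iid_sample n P) (\<lambda>x. f (x i)) \<longleftrightarrow> integrable P f"
proof -
  have X: "(\<lambda>x. x i) \<in> borel_measurable (iid_sample n P)"
    using assms by (intro measurable_iid_sample) auto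
  show "(\<integral>x. f (x i) \<partial>iid_sample n P) = (\<integral>y. f y \<partial>P)"
    by (subst (2) distr_coordinate[OF P \<open>i < n\<close>, symmetric]) (rule integral_distr[OF X f, symmetric])
  show "integrable (iid_sample n P) (\<lambda>x. f (x i)) \<longleftrightarrow> integrable P f"
    by (subst (2) distr_coordinate[OF P \<open>i < n\<close>, symmetric]) (rule integrable_distr_eq[OF X f, symmetric])
qed

lemma integrable_P2:
  assumes "P \<in> P2"
  shows "real_distribution P" "integrable P (\<lambda>x. x)" "integrable P (\<lambda>x. (x - c)\<^sup>2)"
proof -
  show P: "real_distribution P" using assms by (simp add: P2_def)
  interpret real_distribution P by (rule P)
  have sq: "integrable P (\<lambda>x. x\<^sup>2)" using assms by (simp add: P2_def)
  show i: "integrable P (\<lambda>x. x)"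
    by (rule square_integrable_imp_integrable[OF _ sq]) simp
  have "integrable P (\<lambda>x. x\<^sup>2 - 2 * c * x + c\<^sup>2)"
    by (intro Bochner_Integration.integrable_add Bochner_Integration.integrable_diff sq
        integrable_mult_right i) simp
  thus "integrable P (\<lambda>x. (x - c)\<^sup>2)" by (simp add: power2_diff algebra_simps)
qed

text \<open>Distinct centred coordinates are uncorrelated, so only the diagonal of the squared sum
  contributes.\<close>
lemma second_moment_centred_sum:
  assumes "P \<in> P2"
  shows "integrable (iid_sample m P) (\<lambda>x. ((\<Sum>i<m. x i) - real m * mean P)\<^sup>2)"
    and "(\<integral>x. ((\<Sum>i<m. x i) - real m * mean P)\<^sup>2 \<partial>iid_sample m P) = real m * (std_dev P)\<^sup>2"
proof -
  let ?M = "iid_sample m P"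
  define c where "c = mean P"
  note P = integrable_P2[OF assms]
  interpret real_distribution P by (rule P)
  interpret M: prob_space ?M by (rule prob_space_iid_sample[OF P(1)])
  have mean0: "(\<integral>y. y - c \<partial>P) = 0"
    using P(2) prob_space by (simp add: c_def mean_def)
  have centred_int: "integrable P (\<lambda>y. y - c)"
    using P(2) by simp
  have diag: "integrable ?M (\<lambda>x. (x i - c) * (x i - c))"
      "(\<integral>x. (x i - c) * (x i - c) \<partial>?M) = (std_dev P)\<^sup>2" if "i < m" for i
  proof -
    show "integrable ?M (\<lambda>x. (x i - c) * (x i - c))"
      using integral_coordinate(2)[OF P(1) that, of "\<lambda>y. (y - c)\<^sup>2"] P(3)
      by (simp add: power2_eq_square)
    show "(\<integral>x. (x i - c) * (x i - c) \<partial>?M) = (std_dev P)\<^sup>2"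
      using integral_coordinate(1)[OF P(1) that, of "\<lambda>y. (y - c)\<^sup>2"]
      by (simp add: power2_eq_square std_dev_def c_def)
  qed
  have off: "integrable ?M (\<lambda>x. (x i - c) * (x j - c))"
      "(\<integral>x. (x i - c) * (x j - c) \<partial>?M) = 0" if "i < m" "j < m" "i \<noteq> j" for i j
  proof -
    have "M.indep_vars (\<lambda>_. borel) (\<lambda>i x. x i - c) {..<m}"
      by (rule M.indep_vars_compose2[OF indep_vars_coordinates[OF P(1)]]) (use that in auto)
    hence ind: "M.indep_vars (\<lambda>_. borel) (\<lambda>k x. x k - c) {i, j}"
      by (rule M.indep_vars_subset) (use that in auto)
    have [simp]: "(\<lambda>y. y - c) \<in> borel_measurable borel" by simp
    have int: "integrable ?M (\<lambda>x. x k - c)" if "k < m" for k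
      by (rule integral_coordinate(2)[OF P(1) that, THEN iffD2]) (simp, rule centred_int)
    have e: "(\<integral>x. x k - c \<partial>?M) = 0" if "k < m" for k
      by (subst integral_coordinate(1)[OF P(1) that, of "\<lambda>y. y - c"]) (simp, rule mean0)
    have "integrable ?M (\<lambda>x. \<Prod>k\<in>{i, j}. x k - c)"
      using that by (intro M.indep_vars_integrable[OF _ ind]) (auto intro!: int simp del: Bochner_Integration.integrable_diff)
    thus "integrable ?M (\<lambda>x. (x i - c) * (x j - c))" using \<open>i \<noteq> j\<close> by simp
    have "(\<integral>x. (\<Prod>k\<in>{i, j}. x k - c) \<partial>?M) = (\<Prod>k\<in>{i, j}. \<integral>x. x k - c \<partial>?M)"
      using that by (intro M.indep_vars_lebesgue_integral[OF _ ind]) (auto intro!: int)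
    thus "(\<integral>x. (x i - c) * (x j - c) \<partial>?M) = 0" 
      using \<open>i \<noteq> j\<close> by (simp only: prod.insert finite.intros e that) (simp add: e that)
  qed
  have int: "integrable ?M (\<lambda>x. (x i - c) * (x j - c))" if "i < m" "j < m" for i j
    using diag off that by (cases "i = j") auto
  have eq: "((\<Sum>i<m. x i) - real m * c)\<^sup>2 = (\<Sum>i<m. \<Sum>j<m. (x i - c) * (x j - c))" for x :: "nat \<Rightarrow> real"
  proof -
    have "(\<Sum>i<m. x i) - real m * c = (\<Sum>i<m. x i - c)" by (simp add: sum_subtractf)
    thus ?thesis by (simp add: power2_eq_square sum_product)
  qed
  show "integrable ?M (\<lambda>x. ((\<Sum>i<m. x i) - real m * mean P)\<^sup>2)"
    unfolding c_def[symmetric] eq using int by (intro Bochner_Integration.integrable_sum) auto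
  have "(\<integral>x. ((\<Sum>i<m. x i) - real m * c)\<^sup>2 \<partial>?M) =
        (\<Sum>i<m. \<Sum>j<m. \<integral>x. (x i - c) * (x j - c) \<partial>?M)"
    unfolding eq using int
    by (subst Bochner_Integration.integral_sum; (intro Bochner_Integration.integrable_sum sum.cong refl)?)
       (auto intro!: Bochner_Integration.integral_sum)
  also have "\<dots> = (\<Sum>i<m. \<Sum>j<m. if i = j then (std_dev P)\<^sup>2 else 0)"
    using diag off by (intro sum.cong) auto
  also have "\<dots> = real m * (std_dev P)\<^sup>2" by simp
  finally show "(\<integral>x. ((\<Sum>i<m. x i) - real m * mean P)\<^sup>2 \<partial>?M) = real m * (std_dev P)\<^sup>2"
    by (simp add: c_def)
qed

text \<open>For \<open>\<sigma> = 0\<close> the deviation event is strict, hence null; for \<open>\<sigma> > 0\<close> this is Chebyshev's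
  inequality.\<close>
lemma prob_sample_sum_deviation:
  assumes "P \<in> P2" and m: "m > 0" and "t > 0"
  shows "\<P>(x in iid_sample m P. \<bar>(\<Sum>i<m. x i) - real m * mean P\<bar> > t * std_dev P * sqrt (real m))
           \<le> 1 / t\<^sup>2"
proof -
  let ?M = "iid_sample m P" and ?Z = "\<lambda>x. ((\<Sum>i<m. x i) - real m * mean P)\<^sup>2"
  note P = integrable_P2(1)[OF assms(1)]
  interpret M: prob_space ?M by (rule prob_space_iid_sample[OF P])
  note Z = second_moment_centred_sum[OF assms(1), of m]
  have [measurable]: "(\<lambda>x. x i) \<in> borel_measurable ?M" if "i < m" for i
    using that by (intro measurable_iid_sample[OF P]) auto
  have s: "std_dev P \<ge> 0" by (simp add: std_dev_def)
  show ?thesis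
  proof (cases "std_dev P = 0")
    case True
    hence "AE x in ?M. ?Z x = 0"
      using Z integral_nonneg_eq_0_iff_AE[OF Z(1)] by simp
    hence "\<P>(x in ?M. \<bar>(\<Sum>i<m. x i) - real m * mean P\<bar> > t * std_dev P * sqrt (real m)) = 0"
      by (intro M.prob_eq_0[THEN iffD2]) (auto simp: True elim!: eventually_mono)
    thus ?thesis by simp
  next
    case False
    with s have s: "std_dev P > 0" by simp
    define a where "a = t\<^sup>2 * (std_dev P)\<^sup>2 * real m"
    have a: "a > 0" using s m \<open>t > 0\<close> by (simp add: a_def)
    have "\<P>(x in ?M. \<bar>(\<Sum>i<m. x i) - real m * mean P\<bar> > t * std_dev P * sqrt (real m))
        \<le> \<P>(x in ?M. ?Z x \<ge> a)"
    proof (intro M.finite_measure_mono)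
      show "{x \<in> space ?M. \<bar>(\<Sum>i<m. x i) - real m * mean P\<bar> > t * std_dev P * sqrt (real m)}
          \<subseteq> {x \<in> space ?M. ?Z x \<ge> a}"
      proof safe
        fix x assume "t * std_dev P * sqrt (real m) < \<bar>(\<Sum>i<m. x i) - real m * mean P\<bar>"
        hence "(t * std_dev P * sqrt (real m))\<^sup>2 \<le> \<bar>(\<Sum>i<m. x i) - real m * mean P\<bar>\<^sup>2"
          using s \<open>t > 0\<close> by (intro power_mono) auto
        thus "a \<le> ?Z x" by (simp add: a_def power_mult_distrib)
      qed
    qed measurable
    also have "\<dots> \<le> (\<integral>x. ?Z x \<partial>?M) / a"
      by (rule integral_Markov_inequality_measure[where A="{}"]) (use Z a in auto)
    also have "\<dots> = 1 / t\<^sup>2"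
      using s m \<open>t > 0\<close> unfolding Z(2) a_def by (simp add: field_simps)
    finally show ?thesis .
  qed
qed

section \<open>Blocks of a sample\<close>

definition block_mean :: "nat \<Rightarrow> nat \<Rightarrow> nat \<Rightarrow> (nat \<Rightarrow> real) \<Rightarrow> real" where
  "block_mean n b i x = (\<Sum>j<n div b. x (i * (n div b) + j)) / real (n div b)"

lemma block_index_less:
  fixes n :: nat
  assumes "i < b" "j < n div b"
  shows "i * (n div b) + j < n"
proof -
  have "i * (n div b) + j < (i + 1) * (n div b)" using assms by simp
  also have "\<dots> \<le> b * (n div b)" using assms by (intro mult_right_mono) auto
  also have "\<dots> \<le> n" by simp
  finally show ?thesis .
qed

lemma measurable_block_mean [measurable]:
  "i < b \<Longrightarrow> block_mean n b i \<in> borel_measurable (real_space n)"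
  unfolding block_mean_def[abs_def]
  by (intro borel_measurable_divide borel_measurable_sum measurable_coordinate)
     (auto intro: block_index_less)

text \<open>The blocks use disjoint sets of coordinates.\<close>
lemma indep_vars_block_mean:
  assumes P: "real_distribution P" and "n > 0"
  shows "prob_space.indep_vars (iid_sample n P) (\<lambda>_. borel) (block_mean n b) {..<b}"
proof -
  interpret prob_space "iid_sample n P" by (rule prob_space_iid_sample[OF P])
  define m where "m = n div b"
  let ?K = "\<lambda>i. {i * m..<i * m + m}"
  let ?Y = "\<lambda>i y. (\<Sum>j<m. y (i * m + j)) / real m"
  have sub: "?K i \<subseteq> {..<n}" if "i < b" for i
  proof
    fix k assume "k \<in> ?K i"
    then obtain j where "k = i * m + j" "j < m" by (auto dest!: le_Suc_ex)
    thus "k \<in> {..<n}" using block_index_less[of i b j n] that by (simp add: m_def)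
  qed
  have disj: "disjoint_family_on ?K {..<b}"
  unfolding disjoint_family_on_def
  proof (intro ballI impI)
    fix i j :: nat assume "i \<noteq> j"
    hence "Suc i \<le> j \<or> Suc j \<le> i" by auto
    hence "Suc i * m \<le> j * m \<or> Suc j * m \<le> i * m"
      using mult_le_mono1 by blast
    thus "?K i \<inter> ?K j = {}" by auto
  qed
  have "indep_vars (\<lambda>i. PiM (?K i) (\<lambda>_. borel)) (\<lambda>i x. restrict (\<lambda>k. x k) (?K i)) {..<b}"
    by (rule indep_vars_restrict[OF indep_vars_coordinates[OF P \<open>n > 0\<close>] sub disj]) auto
  hence "indep_vars (\<lambda>_. borel) (\<lambda>i x. ?Y i (restrict (\<lambda>k. x k) (?K i))) {..<b}"
    by (rule indep_vars_compose2)
       (intro borel_measurable_divide borel_measurable_sum measurable_component_singleton, auto)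
  also have "(\<lambda>i x. ?Y i (restrict (\<lambda>k. x k) (?K i))) = block_mean n b"
    by (auto simp: block_mean_def[abs_def] m_def fun_eq_iff intro!: sum.cong)
  finally show ?thesis .
qed

text \<open>A block of a sample is itself a sample of smaller size.\<close>
lemma prob_block_mean:
  assumes P: "real_distribution P" and "i < b" and [measurable]: "A \<in> sets borel"
  shows "\<P>(x in iid_sample n P. block_mean n b i x \<in> A) =
         \<P>(x in iid_sample (n div b) P. (\<Sum>j<n div b. x j) / real (n div b) \<in> A)"
proof -
  define m where "m = n div b"
  have *: "distr (iid_sample n P) (iid_sample m P) (\<lambda>x. \<lambda>j\<in>{..<m}. x (i * m + j)) = iid_sample m P"
    by (rule distr_subsample[OF P])
       (use block_index_less[OF \<open>i < b\<close>] in \<open>auto simp: inj_on_def m_def\<close>)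
  have meas: "(\<lambda>x. \<lambda>j\<in>{..<m}. x (i * m + j)) \<in> measurable (iid_sample n P) (iid_sample m P)"
    unfolding measurable_cong_sets[OF refl sets_iid_sample[OF P]]
    using block_index_less[OF \<open>i < b\<close>] unfolding real_space_def[of m]
    by (intro measurable_iid_sample[OF P] measurable_restrict measurable_coordinate)
       (auto simp: m_def)
  have S: "{x \<in> space (iid_sample m P). (\<Sum>j<m. x j) / real m \<in> A} \<in> sets (iid_sample m P)"
    unfolding sets_iid_sample[OF P] space_iid_sample[OF P] by measurable
  have "\<P>(x in iid_sample m P. (\<Sum>j<m. x j) / real m \<in> A) =
        measure (distr (iid_sample n P) (iid_sample m P) (\<lambda>x. \<lambda>j\<in>{..<m}. x (i * m + j)))
          {x \<in> space (iid_sample m P). (\<Sum>j<m. x j) / real m \<in> A}"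
    by (simp only: *)
  also have "\<dots> = \<P>(x in iid_sample n P. block_mean n b i x \<in> A)"
    unfolding measure_distr[OF meas S]
    using measurable_space[OF meas]
    by (intro arg_cong[where f="measure _"]) (auto simp: block_mean_def m_def[symmetric])
  finally show ?thesis by (simp add: m_def)
qed

lemma prob_block_mean_sides:
  assumes "P \<in> P2_1reg" "i < b" "b \<le> n"
  shows "\<P>(x in iid_sample n P. block_mean n b i x \<le> mean P) \<ge> 1 / 3"
    and "\<P>(x in iid_sample n P. block_mean n b i x \<ge> mean P) \<ge> 1 / 3"
proof -
  have P: "real_distribution P" using assms(1) by (simp add: P2_1reg_def P2_def)
  have m: "n div b \<ge> 1" using assms by (simp add: div_greater_zero_iff Suc_le_eq)
  hence "p_minus P (n div b) \<ge> 1 / 3" "p_plus P (n div b) \<ge> 1 / 3"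
    using assms(1) by (auto simp: P2_1reg_def)
  thus "\<P>(x in iid_sample n P. block_mean n b i x \<le> mean P) \<ge> 1 / 3"
       "\<P>(x in iid_sample n P. block_mean n b i x \<ge> mean P) \<ge> 1 / 3"
    using m prob_block_mean[OF P \<open>i < b\<close>, of "{..mean P}" n]
      prob_block_mean[OF P \<open>i < b\<close>, of "{mean P..}" n]
    by (simp_all add: p_minus_def p_plus_def field_simps)
qed

lemma prob_block_mean_deviation:
  assumes "P \<in> P2" "i < b" "b \<le> n" "t > 0"
  shows "\<P>(x in iid_sample n P.
            \<bar>block_mean n b i x - mean P\<bar> > t * std_dev P / sqrt (real (n div b))) \<le> 1 / t\<^sup>2"
proof -
  define m where "m = n div b"
  have P: "real_distribution P" using assms(1) by (simp add: P2_def)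
  have m: "m > 0" using assms by (simp add: div_greater_zero_iff m_def)
  have sq: "sqrt (real m) * sqrt (real m) = real m" by simp
  have *: "t * std_dev P / sqrt (real m) < \<bar>s / real m - mean P\<bar> \<longleftrightarrow>
        t * std_dev P * sqrt (real m) < \<bar>s - real m * mean P\<bar>" for s
  proof -
    have "\<bar>s / real m - mean P\<bar> = \<bar>(s - real m * mean P) / real m\<bar>"
      using m by (simp add: diff_divide_distrib)
    also have "\<dots> = \<bar>s - real m * mean P\<bar> / real m" by simp
    finally have "t * std_dev P / sqrt (real m) < \<bar>s / real m - mean P\<bar> \<longleftrightarrow>
        t * std_dev P / sqrt (real m) * real m < \<bar>s - real m * mean P\<bar>"
      using m by (simp add: pos_less_divide_eq)
    moreover have "t * std_dev P / sqrt (real m) * real m = t * std_dev P * sqrt (real m)"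
      using m by (subst (2) sq[symmetric]) (simp del: real_sqrt_mult_self)
    ultimately show ?thesis by simp
  qed
  have "{y. t * std_dev P / sqrt (real m) < \<bar>y - mean P\<bar>} \<in> sets borel" by measurable
  from prob_block_mean[OF P \<open>i < b\<close> this, of n]
  have "\<P>(x in iid_sample n P. \<bar>block_mean n b i x - mean P\<bar> > t * std_dev P / sqrt (real m)) =
     \<P>(x in iid_sample m P. \<bar>(\<Sum>i<m. x i) - real m * mean P\<bar> > t * std_dev P * sqrt (real m))"
    by (simp add: m_def[symmetric] *)
  also have "\<dots> \<le> 1 / t\<^sup>2" using prob_sample_sum_deviation assms m by blast
  finally show ?thesis by (simp add: m_def)
qed

section \<open>Counting independent events\<close>

lemma measurable_card_count:
  fixes b :: nat
  assumes Y: "\<And>i. i < b \<Longrightarrow> Y i \<in> borel_measurable M" and [measurable]: "A \<in> sets borel"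
  shows "(\<lambda>x. card {i \<in> {..<b}. Y i x \<in> A}) \<in> measurable M (count_space UNIV)"
proof -
  have "(\<lambda>x. card {i \<in> {..<b}. Y i x \<in> A}) = (\<lambda>x. \<Sum>i<b. if Y i x \<in> A then 1 else 0)"
    by (simp only: card_eq_sum sum.inter_filter finite_lessThan)
  moreover have "\<dots> \<in> measurable M (count_space UNIV)"
    by (rule measurable_sum_nat) (use Y in measurable)
  ultimately show ?thesis by (simp only:)
qed

text \<open>The count is a sum of independent indicators with expectation at least \<open>p b\<close>, so Hoeffding's
  inequality applies.\<close>
lemma (in prob_space) prob_card_le:
  assumes ind: "indep_vars (\<lambda>_. borel) Y {..<b}" and [measurable]: "A \<in> sets borel"
    and p: "\<And>i. i < b \<Longrightarrow> prob {x \<in> space M. Y i x \<in> A} \<ge> p" and "b > 0" "\<epsilon> \<ge> 0"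
  shows "prob {x \<in> space M. real (card {i\<in>{..<b}. Y i x \<in> A}) \<le> (p - \<epsilon>) * real b}
           \<le> exp (- 2 * \<epsilon>\<^sup>2 * real b)"
proof -
  have Y [measurable]: "random_variable borel (Y i)" if "i < b" for i
    using ind that by (auto simp: indep_vars_def)
  define X :: "nat \<Rightarrow> 'a \<Rightarrow> real" where "X = (\<lambda>i x. indicator A (Y i x))"
  have E: "expectation (X i) = prob {x \<in> space M. Y i x \<in> A}" if "i < b" for i
  proof -
    have "expectation (X i) = expectation (indicator {x \<in> space M. Y i x \<in> A})"
      unfolding X_def by (intro Bochner_Integration.integral_cong) (auto simp: indicator_def)
    thus ?thesis using that by simp
  qed
  interpret Hoeffding_ineq M "{..<b}" X "\<lambda>_. 0" "\<lambda>_. 1" "\<Sum>i<b. expectation (X i)"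
    by unfold_locales
       (auto simp: X_def indicator_def[abs_def] intro!: indep_vars_compose2[OF ind, unfolded X_def])
  have card: "(\<Sum>i<b. X i x) = real (card {i\<in>{..<b}. Y i x \<in> A})" for x
    by (simp add: X_def indicator_def sum.If_cases Int_def)
  have "real b * p \<le> (\<Sum>i<b. expectation (X i))"
    using sum_mono[of "{..<b}" "\<lambda>_. p" "\<lambda>i. expectation (X i)"] p E by simp
  hence "prob {x \<in> space M. real (card {i\<in>{..<b}. Y i x \<in> A}) \<le> (p - \<epsilon>) * real b} \<le>
      prob {x\<in>space M. (\<Sum>i<b. X i x) \<le> (\<Sum>i<b. expectation (X i)) - \<epsilon> * real b}"
    unfolding card[symmetric] by (intro finite_measure_mono) (auto simp: X_def algebra_simps)
  also have "\<dots> \<le> exp (-2 * (\<epsilon> * real b)\<^sup>2 / (\<Sum>i<b. (1 - 0)\<^sup>2))"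
    by (rule Hoeffding_ineq_le) (use \<open>b > 0\<close> \<open>\<epsilon> \<ge> 0\<close> in auto)
  also have "-2 * (\<epsilon> * real b)\<^sup>2 / (\<Sum>i<b. (1 - 0)\<^sup>2) = - 2 * \<epsilon>\<^sup>2 * real b"
    using \<open>b > 0\<close> by (simp add: power2_eq_square)
  finally show ?thesis .
qed

text \<open>Count the complementary events.\<close>
lemma (in prob_space) prob_card_ge:
  assumes ind: "indep_vars (\<lambda>_. borel) Y {..<b}" and [measurable]: "A \<in> sets borel"
    and p: "\<And>i. i < b \<Longrightarrow> prob {x \<in> space M. Y i x \<in> A} \<le> p" and "b > 0" "\<epsilon> \<ge> 0"
  shows "prob {x \<in> space M. real (card {i\<in>{..<b}. Y i x \<in> A}) \<ge> (p + \<epsilon>) * real b}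
           \<le> exp (- 2 * \<epsilon>\<^sup>2 * real b)"
proof -
  have Y [measurable]: "random_variable borel (Y i)" if "i < b" for i
    using ind that by (auto simp: indep_vars_def)
  have "prob {x \<in> space M. Y i x \<in> - A} \<ge> 1 - p" if "i < b" for i
  proof -
    have "prob {x \<in> space M. Y i x \<notin> A} = 1 - prob {x \<in> space M. Y i x \<in> A}"
      by (intro prob_neg) (use that in measurable)
    thus ?thesis using p[OF that] by simp
  qed
  hence **: "prob {x \<in> space M. real (card {i\<in>{..<b}. Y i x \<in> - A}) \<le> (1 - p - \<epsilon>) * real b}
      \<le> exp (- 2 * \<epsilon>\<^sup>2 * real b)"
    by (intro prob_card_le[OF ind] assms) auto
  have *: "real (card {i\<in>{..<b}. Y i x \<in> - A}) = real b - real (card {i\<in>{..<b}. Y i x \<in> A})" for x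
  proof -
    let ?T = "{i\<in>{..<b}. Y i x \<in> A}"
    have "{i\<in>{..<b}. Y i x \<in> - A} = {..<b} - ?T" by auto
    moreover have "card ({..<b} - ?T) = card {..<b} - card ?T" by (rule card_Diff_subset) auto
    moreover have "card ?T \<le> card {..<b}" by (rule card_mono) auto
    ultimately show ?thesis by (simp only: card_lessThan of_nat_diff)
  qed
  have "real (card {i\<in>{..<b}. Y i x \<in> - A}) \<le> (1 - p - \<epsilon>) * real b \<longleftrightarrow>
      real (card {i\<in>{..<b}. Y i x \<in> A}) \<ge> (p + \<epsilon>) * real b" for x
    unfolding * by (auto simp: algebra_simps)
  with ** show ?thesis by (simp only:)
qed

section \<open>Order statistics\<close>

text \<open>The \<open>k\<close>-th smallest of \<open>y 0, \<dots>, y (b - 1)\<close>, counted with multiplicity. It is described by a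
  counting condition because events about it are bounded by counting block means.\<close>
definition order_stat :: "nat \<Rightarrow> nat \<Rightarrow> (nat \<Rightarrow> real) \<Rightarrow> real" where
  "order_stat b k y = Min {t \<in> y ` {..<b}. k \<le> card {i \<in> {..<b}. y i \<le> t}}"

text \<open>If \<open>k\<close> values are at most \<open>t\<close>, then the largest of these values is itself a candidate for the
  minimum.\<close>
lemma order_stat_le_iff:
  assumes "1 \<le> k" "k \<le> b"
  shows "order_stat b k y \<le> t \<longleftrightarrow> k \<le> card {i \<in> {..<b}. y i \<le> t}"
proof -
  let ?S = "{t \<in> y ` {..<b}. k \<le> card {i \<in> {..<b}. y i \<le> t}}"
  have fin: "finite ?S" by simp
  have mem: "Max (y ` {i \<in> {..<b}. y i \<le> t}) \<in> ?S \<and> Max (y ` {i \<in> {..<b}. y i \<le> t}) \<le> t"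
    if k: "k \<le> card {i \<in> {..<b}. y i \<le> t}" for t
  proof -
    let ?T = "{i \<in> {..<b}. y i \<le> t}"
    define s where "s = Max (y ` ?T)"
    have ne: "?T \<noteq> {}" using k assms by (metis card.empty not_one_le_zero order_trans)
    hence s: "s \<in> y ` ?T" unfolding s_def by (intro Max_in) auto
    have "{i \<in> {..<b}. y i \<le> s} = ?T"
      using s by (auto simp: s_def intro!: Max_ge)
    hence "s \<in> ?S \<and> s \<le> t" using s k by auto
    thus ?thesis by (simp only: s_def)
  qed
  have "{i \<in> {..<b}. y i \<le> Max (y ` {..<b})} = {..<b}" by auto
  hence "k \<le> card {i \<in> {..<b}. y i \<le> Max (y ` {..<b})}" using assms by simp
  hence "?S \<noteq> {}" using mem by blast
  hence in_S: "order_stat b k y \<in> ?S"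
    unfolding order_stat_def using fin by (intro Min_in) auto
  show ?thesis
  proof
    assume "order_stat b k y \<le> t"
    hence "card {i \<in> {..<b}. y i \<le> order_stat b k y} \<le> card {i \<in> {..<b}. y i \<le> t}"
      by (intro card_mono) auto
    thus "k \<le> card {i \<in> {..<b}. y i \<le> t}" using in_S by simp
  next
    assume "k \<le> card {i \<in> {..<b}. y i \<le> t}"
    from mem[OF this] show "order_stat b k y \<le> t"
      unfolding order_stat_def using Min_le[OF fin] order_trans by blast
  qed
qed

text \<open>Every sublevel set is determined by a finite count.\<close>
lemma measurable_order_stat:
  assumes "1 \<le> k" "k \<le> b" and Y: "\<And>i. i < b \<Longrightarrow> Y i \<in> borel_measurable M"
  shows "(\<lambda>x. order_stat b k (\<lambda>i. Y i x)) \<in> borel_measurable M"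
proof (rule borel_measurableI_le)
  fix t
  have [measurable]: "(\<lambda>x. card {i \<in> {..<b}. Y i x \<le> t}) \<in> measurable M (count_space UNIV)"
    using measurable_card_count[of b Y M "{..t}"] Y by simp
  show "{x \<in> space M. order_stat b k (\<lambda>i. Y i x) \<le> t} \<in> sets M"
    unfolding order_stat_le_iff[OF assms(1,2)] by measurable
qed

section \<open>The estimator\<close>

text \<open>The fraction \<open>1/6\<close> leaves room for Hoeffding's inequality on both sides: it is below the \<open>1/3\<close>
  guaranteed on each side of the mean and above the \<open>1/36\<close> of outliers.\<close>
definition sixth_rank :: "nat \<Rightarrow> nat" where
  "sixth_rank b = nat \<lceil>real b / 6\<rceil>"

definition lower_end :: "nat \<Rightarrow> nat \<Rightarrow> (nat \<Rightarrow> real) \<Rightarrow> real" where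
  "lower_end n b x = order_stat b (sixth_rank b) (\<lambda>i. block_mean n b i x)"

text \<open>The \<open>\<lceil>b/6\<rceil>\<close>-th largest block mean, expressed as an order statistic by reflection.\<close>
definition upper_end :: "nat \<Rightarrow> nat \<Rightarrow> (nat \<Rightarrow> real) \<Rightarrow> real" where
  "upper_end n b x = - order_stat b (sixth_rank b) (\<lambda>i. - block_mean n b i x)"

text \<open>The second argument is the number of intervals used so far. The intervals are used in order of
  increasing reliability, because the last ones have the final say.\<close>
primrec estimator :: "nat \<Rightarrow> nat \<Rightarrow> (nat \<Rightarrow> real) \<Rightarrow> real" where
  "estimator n 0 x = 0"
| "estimator n (Suc b) x = max (lower_end n (Suc b) x) (min (upper_end n (Suc b) x) (estimator n b x))"

lemma sixth_rank_bounds: "b \<ge> 1 \<Longrightarrow> 1 \<le> sixth_rank b" "sixth_rank b \<le> b"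
  unfolding sixth_rank_def by linarith+

lemma sixth_rank_le_iff: "b \<ge> 1 \<Longrightarrow> sixth_rank b \<le> c \<longleftrightarrow> real b / 6 \<le> real c"
  unfolding sixth_rank_def by linarith

lemma lower_end_le_iff:
  "b \<ge> 1 \<Longrightarrow> lower_end n b x \<le> t \<longleftrightarrow> real b / 6 \<le> real (card {i \<in> {..<b}. block_mean n b i x \<le> t})"
  unfolding lower_end_def
  using order_stat_le_iff[of "sixth_rank b" b "\<lambda>i. block_mean n b i x" t] sixth_rank_bounds[of b]
  by (simp only: sixth_rank_le_iff)

lemma upper_end_ge_iff:
  "b \<ge> 1 \<Longrightarrow> upper_end n b x \<ge> t \<longleftrightarrow> real b / 6 \<le> real (card {i \<in> {..<b}. block_mean n b i x \<ge> t})"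
  using order_stat_le_iff[of "sixth_rank b" b "\<lambda>i. - block_mean n b i x" "- t"] sixth_rank_bounds[of b]
  unfolding upper_end_def by (simp only: sixth_rank_le_iff neg_le_iff_le le_minus_iff minus_minus)

lemma measurable_interval_ends [measurable]:
  assumes "b \<ge> 1"
  shows "lower_end n b \<in> borel_measurable (real_space n)" "upper_end n b \<in> borel_measurable (real_space n)"
  unfolding lower_end_def[abs_def] upper_end_def[abs_def] using sixth_rank_bounds assms
  by (auto intro!: measurable_order_stat borel_measurable_uminus measurable_block_mean)

lemma measurable_estimator: "estimator n b \<in> borel_measurable (real_space n)"
proof (induction b)
  case (Suc b)
  note [measurable] = Suc
  have [measurable]: "Suc b \<ge> 1" by simp
  show ?case
    by (subst estimator.simps(2)[abs_def]) measurable
qed (simp add: estimator.simps(1)[abs_def])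

text \<open>Clamping to an interval that contains \<open>\<mu>\<close> never increases the distance to \<open>\<mu>\<close>. So once
  the estimate has been clamped into a short interval around \<open>\<mu>\<close>, all later clamps are
  harmless; what happened before does not matter.\<close>
lemma estimator_close:
  assumes "1 \<le> b0" "b0 \<le> N"
    and contains: "\<And>b. b0 \<le> b \<Longrightarrow> b \<le> N \<Longrightarrow> lower_end n b x \<le> \<mu> \<and> \<mu> \<le> upper_end n b x"
    and short: "\<mu> - w \<le> lower_end n b0 x" "upper_end n b0 x \<le> \<mu> + w"
  shows "\<bar>estimator n N x - \<mu>\<bar> \<le> w"
  using \<open>b0 \<le> N\<close> contains
proof (induction N rule: dec_induct)
  case base
  obtain b where b: "b0 = Suc b" using \<open>1 \<le> b0\<close> by (cases b0) auto
  show ?case using short base[of b0] unfolding b estimator.simps by linarith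
next
  case (step N)
  have "\<bar>estimator n N x - \<mu>\<bar> \<le> w" using step.IH step.prems by simp
  moreover have "lower_end n (Suc N) x \<le> \<mu> \<and> \<mu> \<le> upper_end n (Suc N) x"
    using step.hyps step.prems[of "Suc N"] by simp
  ultimately show ?case unfolding estimator.simps by linarith
qed

section \<open>Confidence of the intervals\<close>

text \<open>The interval lies to the right of \<open>\<mu>\<close> only if fewer than a sixth of the block means are at most
  \<open>\<mu>\<close>, while at least a third of them is expected there; likewise on the left.\<close>
lemma prob_interval_misses_mean:
  assumes P: "P \<in> P2_1reg" and b: "1 \<le> b" "b \<le> n"
  shows "\<P>(x in iid_sample n P. \<not> (lower_end n b x \<le> mean P \<and> mean P \<le> upper_end n b x))
           \<le> 2 * exp (- (real b / 18))"
proof -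
  let ?M = "iid_sample n P"
  have rP: "real_distribution P" using P by (simp add: P2_1reg_def P2_def)
  interpret prob_space ?M by (rule prob_space_iid_sample[OF rP])
  have ind: "indep_vars (\<lambda>_. borel) (block_mean n b) {..<b}"
    using b by (intro indep_vars_block_mean[OF rP]) auto
  have [measurable]: "lower_end n b \<in> borel_measurable ?M" "upper_end n b \<in> borel_measurable ?M"
    using b by (auto intro!: measurable_iid_sample[OF rP] measurable_interval_ends)
  have one_side: "\<P>(x in ?M. real (card {i \<in> {..<b}. block_mean n b i x \<in> A}) \<le> real b / 6)
      \<le> exp (- (real b / 18))"
    if A: "A \<in> sets borel" and p: "\<And>i. i < b \<Longrightarrow> 1 / 3 \<le> \<P>(x in ?M. block_mean n b i x \<in> A)" for A
  proof -
    have "exp (- (real b / 18)) = exp (- 2 * (1 / 6)\<^sup>2 * real b)" by (simp add: power2_eq_square)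
    moreover have "real b / 6 = (1 / 3 - 1 / 6) * real b" by simp
    moreover have "b > 0" using b by simp
    note prob_card_le[OF ind A p this, of "1 / 6"]
    ultimately show ?thesis by (simp only: zero_le_divide_1_iff zero_le_numeral)
  qed
  have Y: "random_variable borel (block_mean n b i)" if "i < b" for i
    using that by (intro measurable_iid_sample[OF rP] measurable_block_mean)
  have count: "{x \<in> space ?M. real (card {i \<in> {..<b}. block_mean n b i x \<in> A}) \<le> r} \<in> events"
    if "A \<in> sets borel" for A r
  proof -
    note [measurable] = measurable_card_count[OF Y that]
    show ?thesis by measurable
  qed
  have low: "\<P>(x in ?M. \<not> lower_end n b x \<le> mean P) \<le> exp (- (real b / 18))"
  proof -
    let ?few = "{x \<in> space ?M. real (card {i \<in> {..<b}. block_mean n b i x \<in> {..mean P}}) \<le> real b / 6}"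
    have "{x \<in> space ?M. \<not> lower_end n b x \<le> mean P} \<subseteq> ?few"
      unfolding lower_end_le_iff[OF b(1)] atMost_iff atLeast_iff by (rule Collect_mono) linarith
    moreover have "?few \<in> events" by (rule count) simp
    ultimately have "\<P>(x in ?M. \<not> lower_end n b x \<le> mean P) \<le> prob ?few"
      by (rule finite_measure_mono)
    also have "\<dots> \<le> exp (- (real b / 18))"
    proof (rule one_side)
      show "1 / 3 \<le> \<P>(x in ?M. block_mean n b i x \<in> {..mean P})" if "i < b" for i
        using prob_block_mean_sides(1)[OF P that b(2)] by (simp only: atMost_iff atLeast_iff)
    qed simp
    finally show ?thesis .
  qed
  have upp: "\<P>(x in ?M. \<not> mean P \<le> upper_end n b x) \<le> exp (- (real b / 18))"
  proof -
    let ?few = "{x \<in> space ?M. real (card {i \<in> {..<b}. block_mean n b i x \<in> {mean P..}}) \<le> real b / 6}"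
    have "{x \<in> space ?M. \<not> mean P \<le> upper_end n b x} \<subseteq> ?few"
      unfolding upper_end_ge_iff[OF b(1)] atMost_iff atLeast_iff by (rule Collect_mono) linarith
    moreover have "?few \<in> events" by (rule count) simp
    ultimately have "\<P>(x in ?M. \<not> mean P \<le> upper_end n b x) \<le> prob ?few"
      by (rule finite_measure_mono)
    also have "\<dots> \<le> exp (- (real b / 18))"
    proof (rule one_side)
      show "1 / 3 \<le> \<P>(x in ?M. block_mean n b i x \<in> {mean P..})" if "i < b" for i
        using prob_block_mean_sides(2)[OF P that b(2)] by (simp only: atMost_iff atLeast_iff)
    qed simp
    finally show ?thesis .
  qed
  have "\<P>(x in ?M. \<not> (lower_end n b x \<le> mean P \<and> mean P \<le> upper_end n b x)) \<le>
     measure ?M ({x \<in> space ?M. \<not> lower_end n b x \<le> mean P} \<union> {x \<in> space ?M. \<not> mean P \<le> upper_end n b x})"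
    by (intro finite_measure_mono) auto
  also have "\<dots> \<le> \<P>(x in ?M. \<not> lower_end n b x \<le> mean P) + \<P>(x in ?M. \<not> mean P \<le> upper_end n b x)"
    by (intro measure_Un_le) auto
  also have "\<dots> \<le> exp (- (real b / 18)) + exp (- (real b / 18))"
    by (intro add_mono low upp)
  finally show ?thesis by simp
qed

text \<open>If an end of the interval is further than \<open>w\<close> from the mean, then so is at least a
  sixth of the block means, whereas for \<open>w\<close> equal to six standard deviations of a block mean only a
  fraction \<open>1 / 36\<close> is expected there.\<close>
lemma prob_interval_long:
  fixes b n :: nat and P :: "real measure"
  defines "w \<equiv> 6 * std_dev P / sqrt (real (n div b))"
  assumes P: "P \<in> P2" and b: "1 \<le> b" "b \<le> n"
  shows "\<P>(x in iid_sample n P. \<not> (mean P - w \<le> lower_end n b x \<and> upper_end n b x \<le> mean P + w))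
           \<le> exp (- (real b / 26))"
proof -
  let ?M = "iid_sample n P"
  let ?A = "{y. \<bar>y - mean P\<bar> > w}"
  have rP: "real_distribution P" using P by (simp add: P2_def)
  interpret prob_space ?M by (rule prob_space_iid_sample[OF rP])
  have ind: "indep_vars (\<lambda>_. borel) (block_mean n b) {..<b}"
    using b by (intro indep_vars_block_mean[OF rP]) auto
  have Y [measurable]: "random_variable borel (block_mean n b i)" if "i < b" for i
    using that by (intro measurable_iid_sample[OF rP] measurable_block_mean)
  have A [measurable]: "?A \<in> sets borel" by measurable
  have le: "real b / 6 \<le> real (card {i \<in> {..<b}. block_mean n b i x \<in> ?A})"
    if out: "\<not> (mean P - w \<le> lower_end n b x \<and> upper_end n b x \<le> mean P + w)" for x
  proof -
    have "real b / 6 \<le> real (card {i \<in> {..<b}. block_mean n b i x \<le> lower_end n b x})"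
         "real b / 6 \<le> real (card {i \<in> {..<b}. block_mean n b i x \<ge> upper_end n b x})"
      using lower_end_le_iff[OF b(1), of n x "lower_end n b x"] upper_end_ge_iff[OF b(1), of "upper_end n b x" n x]
      by auto
    moreover have "{i \<in> {..<b}. block_mean n b i x \<le> lower_end n b x} \<subseteq> {i \<in> {..<b}. block_mean n b i x \<in> ?A}
        \<or> {i \<in> {..<b}. block_mean n b i x \<ge> upper_end n b x} \<subseteq> {i \<in> {..<b}. block_mean n b i x \<in> ?A}"
      using out by auto
    hence "card {i \<in> {..<b}. block_mean n b i x \<le> lower_end n b x} \<le> card {i \<in> {..<b}. block_mean n b i x \<in> ?A}
        \<or> card {i \<in> {..<b}. block_mean n b i x \<ge> upper_end n b x} \<le> card {i \<in> {..<b}. block_mean n b i x \<in> ?A}"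
      by (auto intro: card_mono)
    ultimately show ?thesis by linarith
  qed
  have [measurable]: "(\<lambda>x. card {i \<in> {..<b}. block_mean n b i x \<in> ?A}) \<in> measurable ?M (count_space UNIV)"
    by (rule measurable_card_count[OF Y A])
  have "\<P>(x in ?M. \<not> (mean P - w \<le> lower_end n b x \<and> upper_end n b x \<le> mean P + w)) \<le>
     \<P>(x in ?M. real (card {i \<in> {..<b}. block_mean n b i x \<in> ?A}) \<ge> (1 / 36 + 5 / 36) * real b)"
  proof (rule finite_measure_mono)
    show "{x \<in> space ?M. (1 / 36 + 5 / 36) * real b \<le> real (card {i \<in> {..<b}. block_mean n b i x \<in> ?A})} \<in> events"
      by measurable
  qed (use le in auto)
  also have "\<dots> \<le> exp (- 2 * (5 / 36)\<^sup>2 * real b)"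
    using prob_block_mean_deviation[OF P _ b(2), of _ 6] b
    by (intro prob_card_ge[OF ind A]) (auto simp: w_def)
  also have "\<dots> \<le> exp (- (real b / 26))" by (simp add: power2_eq_square)
  finally show ?thesis .
qed

text \<open>A geometric series; the factor comes from \<open>1 / (1 - exp (- x)) \<le> 1 + 1 / x\<close> at \<open>x = 1/18\<close>.\<close>
lemma sum_exp_tail:
  fixes b0 n :: nat
  shows "(\<Sum>b\<in>{b0..n}. exp (- (real b / 18))) \<le> 19 * exp (- (real b0 / 18))"
proof (cases "b0 \<le> n")
  case True
  define q :: real where "q = exp (- (1 / 18))"
  have q: "0 < q" "q < 1" by (simp_all add: q_def)
  have pow: "exp (- (real b / 18)) = q ^ b" for b
    by (simp add: q_def exp_of_nat_mult[symmetric])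
  have "19 / 18 \<le> exp (1 / 18 :: real)" using exp_ge_add_one_self[of "1/18"] by simp
  hence "q * (19 / 18) \<le> q * exp (1 / 18)" using q by (intro mult_left_mono) auto
  also have "\<dots> = 1" by (simp add: q_def exp_minus)
  finally have q': "19 * (1 - q) \<ge> 1" by simp
  have "(\<Sum>b\<in>{b0..n}. q ^ b) = (q ^ b0 - q ^ Suc n) / (1 - q)"
    using q True by (subst sum_gp) (auto simp: field_simps)
  also have "\<dots> \<le> q ^ b0 / (1 - q)" using q by (intro divide_right_mono) auto
  also have "\<dots> \<le> 19 * q ^ b0"
    using q mult_left_mono[OF q', of "q ^ b0"] by (simp add: pos_divide_le_eq mult_ac)
  finally show ?thesis by (simp add: pow)
qed simp

section \<open>The estimator is sub-Gaussian\<close>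

text \<open>From \<open>ln 3 \<ge> 1\<close> and \<open>exp 1 \<ge> 2\<close>: a crude bound that is all the radius requires.\<close>
lemma L_star_square_ge: "32 * 63 * 32 \<le> L_star\<^sup>2"
proof -
  have ln3: "ln 3 \<ge> (1::real)"
    using exp_le by (subst ln_ge_iff) auto
  have e: "32 \<le> exp (5 :: real)"
  proof -
    have "(2::real) ^ 5 \<le> exp 1 ^ 5" using exp_ge_add_one_self[of 1] by (intro power_mono) auto
    thus ?thesis by (simp add: exp_of_nat_mult[symmetric])
  qed
  have "L_star\<^sup>2 = (32 * (1 + 2 * ln 2) * (1 + 62 * ln 3)) * exp 5"
    using ln3 by (simp add: L_star_def power_mult_distrib exp_double[symmetric])
  moreover have "32 * 1 * 63 \<le> 32 * (1 + 2 * ln 2) * (1 + 62 * ln (3::real))"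
    using ln3 by (intro mult_mono) (simp_all del: ln_ge_iff)
  hence "(32 * 1 * 63) * 32 \<le> (32 * (1 + 2 * ln 2) * (1 + 62 * ln 3)) * exp (5::real)"
    using e ln3 by (intro mult_mono) (simp_all del: ln_ge_iff)
  ultimately show ?thesis by simp
qed

text \<open>The lower bound on \<open>n\<close> and the smallest \<open>\<delta>\<close> enter only to make sure that the \<open>b\<^sub>0\<close> blocks needed for
  level \<open>\<delta>\<close> are available.\<close>
lemma estimator_subgaussian:
  assumes n: "real n \<ge> (3 + ln 4) * 124"
  shows "multiple_delta_subgaussian L_star P2_1reg n (delta_min1 n) (estimator n n)"
  unfolding multiple_delta_subgaussian_def
proof (intro conjI ballI measurable_estimator)
  fix \<delta> P assume \<delta>: "\<delta> \<in> {delta_min1 n..<1}" and P: "P \<in> P2_1reg"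
  let ?M = "iid_sample n P"
  define l where "l = ln (1 / \<delta>)"
  \<comment> \<open>All failure probabilities together are at most \<open>39 exp (- b0 / 26)\<close>; the constant 6 absorbs
    the factor, as \<open>exp (- 6) \<le> 1 / 64\<close>.\<close>
  define b0 where "b0 = nat \<lceil>26 * (6 + l)\<rceil>"
  define w where "w = 6 * std_dev P / sqrt (real (n div b0))"
  have P2: "P \<in> P2" using P by (simp add: P2_1reg_def)
  have rP: "real_distribution P" using P2 by (simp add: P2_def)
  interpret prob_space ?M by (rule prob_space_iid_sample[OF rP])
  have s: "std_dev P \<ge> 0" by (simp add: std_dev_def)
  have "\<delta> > 0" using \<delta> less_le_trans[of 0 "delta_min1 n" \<delta>] by (simp add: delta_min1_def)
  have l: "l \<ge> 0" using \<delta> \<open>\<delta> > 0\<close> by (simp add: l_def)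
  have ln4: "ln 4 \<ge> (0::real)" by simp
  have "exp (ln 4 + (3 - real n / 124)) \<le> exp (- l)"
    using \<delta> \<open>\<delta> > 0\<close> by (simp add: delta_min1_def exp_add l_def ln_div)
  hence l_le: "l \<le> real n / 124 - 3 - ln 4" by simp
  have b0_ge: "real b0 \<ge> 156 + 26 * l" and b0_le: "real b0 \<le> 157 + 26 * l"
  proof -
    define a where "a = 156 + 26 * l"
    have "real b0 = of_int \<lceil>a\<rceil>" using l by (simp add: b0_def a_def)
    thus "real b0 \<ge> 156 + 26 * l" "real b0 \<le> 157 + 26 * l"
      using ceiling_correct[of a] unfolding a_def by linarith+
  qed
  have "l \<le> real n / 124 - 3" using l_le ln4 by linarith
  moreover have "3 * 124 \<le> (3 + ln 4) * (124 :: real)" using ln4 by (intro mult_right_mono) auto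
  hence "real n \<ge> 372" using n by linarith
  ultimately have "real b0 \<le> real n" using b0_le by linarith
  hence b0_n: "b0 \<le> n" by simp
  have "real b0 \<ge> 1" using b0_ge l by linarith
  hence b0: "1 \<le> b0" by simp

  have radius: "w \<le> L_star * std_dev P * sqrt ((1 + ln (1 / \<delta>)) / real n)"
  proof -
    define m where "m = n div b0"
    have m: "m \<ge> 1" using b0 b0_n by (simp add: m_def div_greater_zero_iff Suc_le_eq)
    have "n < (m + 1) * b0" unfolding m_def using b0 by (simp add: dividend_less_div_times)
    also have "\<dots> \<le> 2 * m * b0" using m by (intro mult_right_mono) auto
    finally have nm: "real n \<le> 2 * real m * real b0"
      by (metis less_imp_le of_nat_le_iff of_nat_mult of_nat_numeral)
    have n0: "real n > 0" using b0 b0_n by simp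
    \<comment> \<open>Here \<open>72 b0 \<le> 72 (157 + 26 l)\<close>, whose coefficients \<open>11304\<close> and \<open>1872\<close> are both below
      \<open>32 * 63 * 32 \<le> L_star\<^sup>2\<close>.\<close>
    have "36 / real m \<le> 72 * real b0 / real n"
      using nm m n0 by (simp add: field_simps)
    also have "\<dots> \<le> L_star\<^sup>2 * (1 + l) / real n"
    proof (rule divide_right_mono)
      have "72 * real b0 \<le> (32 * 63 * 32) * (1 + l)"
        unfolding distrib_left using b0_le l by linarith
      also have "\<dots> \<le> L_star\<^sup>2 * (1 + l)" using L_star_square_ge l by (intro mult_right_mono) auto
      finally show "72 * real b0 \<le> L_star\<^sup>2 * (1 + l)" .
    qed simp
    finally have "sqrt (36 / real m) \<le> sqrt (L_star\<^sup>2 * ((1 + l) / real n))" by simp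
    moreover have "sqrt (36 :: real) = 6" by (rule real_sqrt_unique) auto
    moreover have "L_star \<ge> 0" by (simp add: L_star_def)
    ultimately have "6 / sqrt (real m) \<le> L_star * sqrt ((1 + l) / real n)"
      by (simp add: real_sqrt_divide real_sqrt_mult)
    from mult_left_mono[OF this s] show ?thesis
      by (simp add: w_def m_def l_def mult_ac)
  qed

  define Miss where "Miss = (\<lambda>b. {x \<in> space ?M. \<not> (lower_end n b x \<le> mean P \<and> mean P \<le> upper_end n b x)})"
  define Long where "Long = {x \<in> space ?M. \<not> (mean P - w \<le> lower_end n b0 x \<and> upper_end n b0 x \<le> mean P + w)}"
  have bounds_measurable [measurable]: "lower_end n b \<in> borel_measurable ?M" "upper_end n b \<in> borel_measurable ?M"
    if "b \<ge> 1" for b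
    using that by (auto intro!: measurable_iid_sample[OF rP] measurable_interval_ends)
  have Miss_sets: "Miss b \<in> events" if "b \<ge> 1" for b
    using bounds_measurable[OF that] unfolding Miss_def by measurable
  have Long_sets: "Long \<in> events"
    using bounds_measurable[OF b0] unfolding Long_def by measurable
  have "measure ?M (\<Union>b\<in>{b0..n}. Miss b) \<le> (\<Sum>b\<in>{b0..n}. measure ?M (Miss b))"
    using Miss_sets b0 by (intro measure_UNION_le) auto
  also have "\<dots> \<le> (\<Sum>b\<in>{b0..n}. 2 * exp (- (real b / 18)))"
    unfolding Miss_def using b0 by (intro sum_mono prob_interval_misses_mean[OF P]) auto
  also have "\<dots> \<le> 38 * exp (- (real b0 / 18))"
    using sum_exp_tail[of b0 n] by (simp add: sum_distrib_left[symmetric])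
  also have "\<dots> \<le> 38 * exp (- (real b0 / 26))" by simp
  finally have Miss: "measure ?M (\<Union>b\<in>{b0..n}. Miss b) \<le> 38 * exp (- (real b0 / 26))" .
  have Long: "measure ?M Long \<le> exp (- (real b0 / 26))"
    unfolding Long_def w_def by (rule prob_interval_long[OF P2 b0 b0_n])
  have "\<P>(x in ?M. \<bar>estimator n n x - mean P\<bar> > L_star * std_dev P * sqrt ((1 + ln (1 / \<delta>)) / real n))
      \<le> measure ?M ((\<Union>b\<in>{b0..n}. Miss b) \<union> Long)"
  proof (rule finite_measure_mono)
    show "(\<Union>b\<in>{b0..n}. Miss b) \<union> Long \<in> events"
      using Miss_sets Long_sets b0 by (intro sets.Un sets.finite_UN) auto
    show "{x \<in> space ?M. \<bar>estimator n n x - mean P\<bar> > L_star * std_dev P * sqrt ((1 + ln (1 / \<delta>)) / real n)}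
        \<subseteq> (\<Union>b\<in>{b0..n}. Miss b) \<union> Long"
    proof (rule subsetI, rule ccontr)
      fix x assume x: "x \<in> {x \<in> space ?M. \<bar>estimator n n x - mean P\<bar> > L_star * std_dev P * sqrt ((1 + ln (1 / \<delta>)) / real n)}"
        and good: "x \<notin> (\<Union>b\<in>{b0..n}. Miss b) \<union> Long"
      have "\<bar>estimator n n x - mean P\<bar> \<le> w"
        by (rule estimator_close[OF b0 b0_n]) (use x good in \<open>auto simp: Miss_def Long_def\<close>)
      with x radius show False by auto
    qed
  qed
  also have "\<dots> \<le> measure ?M (\<Union>b\<in>{b0..n}. Miss b) + measure ?M Long"
    using Miss_sets Long_sets b0 by (intro measure_Un_le sets.finite_UN) auto
  also have "\<dots> \<le> 64 * exp (- (real b0 / 26))"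
    using Miss Long exp_ge_zero[of "- (real b0 / 26)"] by linarith
  also have "\<dots> \<le> 64 * exp (- (6 + l))" using b0_ge by simp
  also have "\<dots> = 64 * exp (- 6) * \<delta>"
    using \<open>\<delta> > 0\<close> by (simp add: l_def exp_diff exp_minus ln_div divide_inverse)
  also have "\<dots> \<le> \<delta>"
  proof -
    have "(2::real) ^ 6 \<le> exp 1 ^ 6" using exp_ge_add_one_self[of 1] by (intro power_mono) auto
    hence "64 \<le> exp (6::real)" by (simp add: exp_of_nat_mult[symmetric])
    thus ?thesis using \<open>\<delta> > 0\<close> by (simp add: exp_minus field_simps)
  qed
  finally show "\<P>(x in ?M. \<bar>estimator n n x - mean P\<bar> > L_star * std_dev P * sqrt ((1 + ln (1 / \<delta>)) / real n)) \<le> \<delta>"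
    by simp
qed

section \<open>Symmetric distributions\<close>

text \<open>Reflecting the coordinates keeps them independent and preserves each marginal.\<close>
lemma reflect_iid_sample:
  assumes P: "P \<in> P2_sym" and "j > 0"
  shows "distr (iid_sample j P) (real_space j) (\<lambda>x. \<lambda>i\<in>{..<j}. 2 * mean P - x i) = iid_sample j P"
proof -
  have rP: "real_distribution P" and sym: "distr P borel (\<lambda>x. 2 * mean P - x) = P"
    using P by (auto simp: P2_sym_def P2_def symmetric_around_mean_def)
  interpret prob_space "iid_sample j P" by (rule prob_space_iid_sample[OF rP])
  have coord: "distr (iid_sample j P) borel (\<lambda>x. 2 * mean P - x i) = P" if "i < j" for i
  proof -
    have "distr (iid_sample j P) borel (\<lambda>x. 2 * mean P - x i) =
        distr (distr (iid_sample j P) borel (\<lambda>x. x i)) borel (\<lambda>x. 2 * mean P - x)"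
      using that
      by (subst distr_distr) (auto simp: comp_def intro!: measurable_iid_sample[OF rP] measurable_coordinate)
    thus ?thesis by (simp add: distr_coordinate[OF rP that] sym)
  qed
  have "indep_vars (\<lambda>_. borel) (\<lambda>i x. 2 * mean P - x i) {..<j}"
    by (rule indep_vars_compose2[OF indep_vars_coordinates[OF rP \<open>j > 0\<close>]]) auto
  hence "distr (iid_sample j P) (real_space j) (\<lambda>x. \<lambda>i\<in>{..<j}. 2 * mean P - x i) =
      (\<Pi>\<^sub>M i\<in>{..<j}. distr (iid_sample j P) borel (\<lambda>x. 2 * mean P - x i))"
    unfolding real_space_def
    using \<open>j > 0\<close>
    by (subst (asm) indep_vars_iff_distr_eq_PiM') (auto intro!: measurable_iid_sample[OF rP])
  also have "\<dots> = iid_sample j P"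
    unfolding iid_sample_def by (intro PiM_cong refl) (use coord in \<open>auto simp: iid_sample_def\<close>)
  finally show ?thesis .
qed

text \<open>Reflection exchanges the events \<open>\<Sum> x i \<le> j \<mu>\<close> and \<open>\<Sum> x i \<ge> j \<mu>\<close>, which cover the whole space, so each
  has probability at least \<open>1/2\<close>.\<close>
lemma P2_sym_subset_P2_1reg: "P2_sym \<subseteq> P2_1reg"
proof
  fix P assume P: "P \<in> P2_sym"
  have rP: "real_distribution P" and P2: "P \<in> P2"
    using P by (auto simp: P2_sym_def P2_def)
  have "min (p_plus P j) (p_minus P j) \<ge> 1 / 3" if "j \<ge> 1" for j
  proof -
    let ?M = "iid_sample j P" and ?r = "\<lambda>x. \<lambda>i\<in>{..<j}. 2 * mean P - x i"
    interpret prob_space ?M by (rule prob_space_iid_sample[OF rP])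
    have [measurable]: "(\<lambda>x. x i) \<in> borel_measurable ?M" if "i < j" for i
      using that by (intro measurable_iid_sample[OF rP]) auto
    have r: "?r \<in> measurable ?M (real_space j)"
      unfolding real_space_def by (intro measurable_restrict) auto
    have S: "{x \<in> space (real_space j). (\<Sum>i<j. x i) \<le> real j * mean P} \<in> sets (real_space j)"
      by measurable
    have "p_minus P j = measure (distr ?M (real_space j) ?r)
        {x \<in> space (real_space j). (\<Sum>i<j. x i) \<le> real j * mean P}"
      unfolding reflect_iid_sample[OF P Suc_le_lessD[OF that[unfolded One_nat_def]]]
      by (simp add: p_minus_def space_iid_sample[OF rP])
    also have "\<dots> = measure ?M {x \<in> space ?M. (\<Sum>i<j. 2 * mean P - x i) \<le> real j * mean P}"
      unfolding measure_distr[OF r S] using measurable_space[OF r]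
      by (intro arg_cong[where f="measure _"]) auto
    also have "\<dots> = p_plus P j"
      unfolding p_plus_def by (intro arg_cong[where f="measure _"]) (auto simp: sum_subtractf algebra_simps)
    finally have eq: "p_minus P j = p_plus P j" .
    have "1 = measure ?M ({x \<in> space ?M. (\<Sum>i<j. x i) \<le> real j * mean P} \<union>
        {x \<in> space ?M. (\<Sum>i<j. x i) \<ge> real j * mean P})"
      by (subst prob_space[symmetric]) (intro arg_cong[where f="measure _"], auto)
    also have "\<dots> \<le> p_minus P j + p_plus P j"
      unfolding p_minus_def p_plus_def by (intro measure_Un_le) measurable
    finally show ?thesis using eq by simp
  qed
  with P2 show "P \<in> P2_1reg" by (auto simp: P2_1reg_def)
qed

section \<open>Two indistinguishable symmetric distributions\<close>

text \<open>A fair sign, switched on with probability \<open>p\<close>, is added to the centre \<open>c\<close>. Building the law from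
  two independent coins makes every integral a finite sum.\<close>
definition three_point :: "real \<Rightarrow> real \<Rightarrow> real measure" where
  "three_point p c = distr (measure_pmf (pair_pmf (bernoulli_pmf p) (bernoulli_pmf (1 / 2)))) borel
     (\<lambda>(b, s). if b then if s then c + 1 else c - 1 else c)"

lemma real_distribution_three_point: "real_distribution (three_point p c)"
  unfolding three_point_def
  by (intro prob_space.real_distribution_distr measure_pmf.prob_space_axioms) simp

lemma integral_three_point:
  assumes p: "0 \<le> p" "p \<le> 1" and f: "f \<in> borel_measurable borel"
  shows "integrable (three_point p c) f"
    and "(\<integral>x. f x \<partial>three_point p c) = (1 - p) * f c + p / 2 * f (c + 1) + p / 2 * (f (c - 1) :: real)"
proof -
  let ?D = "pair_pmf (bernoulli_pmf p) (bernoulli_pmf (1 / 2))"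
  let ?X = "\<lambda>(b, s). if b then if s then c + 1 else c - 1 else c"
  have X: "?X \<in> borel_measurable (measure_pmf ?D)" by simp
  have fin: "finite (set_pmf ?D)" by (rule finite_subset[OF subset_UNIV]) simp
  show "integrable (three_point p c) f"
    unfolding three_point_def integrable_distr_eq[OF X f]
    by (rule integrable_measure_pmf_finite[OF fin])
  have "(\<integral>x. f x \<partial>three_point p c) = (\<integral>z. f (?X z) \<partial>measure_pmf ?D)"
    unfolding three_point_def by (rule integral_distr[OF X f])
  also have "\<dots> = (\<Sum>z\<in>UNIV. f (?X z) * pmf ?D z)"
    by (rule integral_measure_pmf_real) auto
  also have "\<dots> = (\<Sum>b\<in>UNIV. \<Sum>s\<in>UNIV. f (?X (b, s)) * pmf ?D (b, s))"
    by (simp only: sum.cartesian_product UNIV_Times_UNIV case_prod_unfold prod.collapse)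
  also have "\<dots> = (1 - p) * f c + p / 2 * f (c + 1) + p / 2 * f (c - 1)"
    using p by (simp add: UNIV_bool pmf_pair algebra_simps)
  finally show "(\<integral>x. f x \<partial>three_point p c) = (1 - p) * f c + p / 2 * f (c + 1) + p / 2 * f (c - 1)" .
qed

lemma three_point_moments:
  assumes p: "0 \<le> p" "p \<le> 1"
  shows "mean (three_point p c) = c" "std_dev (three_point p c) = sqrt p"
proof -
  show m: "mean (three_point p c) = c"
    unfolding mean_def by (subst integral_three_point(2)[OF p]) (simp_all add: field_simps)
  show "std_dev (three_point p c) = sqrt p"
    unfolding std_dev_def m by (subst integral_three_point(2)[OF p]) simp_all
qed

text \<open>Reflection at \<open>c\<close> flips the sign coin, which leaves the law of the two coins unchanged.\<close>
lemma three_point_in_P2_sym: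
  assumes p: "0 \<le> p" "p \<le> 1"
  shows "three_point p c \<in> P2_sym"
proof -
  let ?X = "\<lambda>(b, s). if b then if s then c + 1 else c - 1 else c"
  let ?B = "bernoulli_pmf p" and ?S = "bernoulli_pmf (1 / 2)"
  have "map_pmf Not ?S = ?S"
  proof (rule pmf_eqI)
    fix s
    have "pmf (map_pmf Not ?S) (\<not> \<not> s) = pmf ?S (\<not> s)" by (rule pmf_map_inj') (simp add: inj_def)
    thus "pmf (map_pmf Not ?S) s = pmf ?S s" by (cases s) simp_all
  qed
  hence flip: "map_pmf (\<lambda>(b, s). (b, \<not> s)) (pair_pmf ?B ?S) = pair_pmf ?B ?S"
    using map_pair[of id Not ?B ?S] by (simp add: case_prod_unfold pmf.map_id)
  have "distr (three_point p c) borel (\<lambda>x. 2 * c - x) =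
      distr (measure_pmf (pair_pmf ?B ?S)) borel ((\<lambda>x. 2 * c - x) \<circ> ?X)"
    unfolding three_point_def by (rule distr_distr) auto
  also have "(\<lambda>x. 2 * c - x) \<circ> ?X = ?X \<circ> (\<lambda>(b, s). (b, \<not> s))"
    by (auto simp: fun_eq_iff)
  also have "distr (measure_pmf (pair_pmf ?B ?S)) borel (?X \<circ> (\<lambda>(b, s). (b, \<not> s))) =
      distr (distr (measure_pmf (pair_pmf ?B ?S)) (count_space UNIV) (\<lambda>(b, s). (b, \<not> s))) borel ?X"
    by (rule distr_distr[symmetric]) auto
  also have "distr (measure_pmf (pair_pmf ?B ?S)) (count_space UNIV) (\<lambda>(b, s). (b, \<not> s)) = measure_pmf (pair_pmf ?B ?S)"
    by (subst map_pmf_rep_eq[symmetric]) (rule arg_cong[OF flip])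
  finally have "distr (three_point p c) borel (\<lambda>x. 2 * c - x) = three_point p c"
    by (simp add: three_point_def)
  thus ?thesis
    using integral_three_point(1)[OF p, of "\<lambda>x. x\<^sup>2" c] real_distribution_three_point[of p c]
    by (simp add: P2_sym_def P2_def symmetric_around_mean_def three_point_moments[OF p])
qed

lemma three_point_atom:
  assumes p: "0 \<le> p" "p \<le> 1" and a: "a = c + 1 \<or> a = c - 1"
  shows "p / 2 \<le> measure (three_point p c) {a}"
proof -
  interpret real_distribution "three_point p c" by (rule real_distribution_three_point)
  have "measure (three_point p c) {a} = (\<integral>x. indicator {a} x \<partial>three_point p c)" by simp
  also have "\<dots> = (1 - p) * indicator {a} c + p / 2 * indicator {a} (c + 1) + p / 2 * indicator {a} (c - 1)"
    by (rule integral_three_point(2)[OF p]) simp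
  also have "\<dots> \<ge> p / 2" using p a by (auto simp: indicator_def)
  finally show ?thesis .
qed

lemma prob_constant_sample:
  assumes P: "real_distribution P" and q: "0 \<le> q" "q \<le> measure P {a}"
  shows "(\<lambda>i\<in>{..<n}. a) \<in> space (iid_sample n P)" "{\<lambda>i\<in>{..<n}. a} \<in> sets (iid_sample n P)"
    and "q ^ n \<le> measure (iid_sample n P) {\<lambda>i\<in>{..<n}. a}"
proof -
  interpret real_distribution P by (rule P)
  interpret finite_product_prob_space "\<lambda>_. P" "{..<n}" by unfold_locales simp
  have eq: "{\<lambda>i\<in>{..<n}. a} = (\<Pi>\<^sub>E i\<in>{..<n}. {a})" by (simp add: PiE_singleton)
  show "(\<lambda>i\<in>{..<n}. a) \<in> space (iid_sample n P)"
    by (simp add: iid_sample_def space_PiM)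
  show "{\<lambda>i\<in>{..<n}. a} \<in> sets (iid_sample n P)"
    unfolding eq iid_sample_def by (rule sets_PiM_I_finite) auto
  have "measure (iid_sample n P) {\<lambda>i\<in>{..<n}. a} = measure P {a} ^ n"
    unfolding eq iid_sample_def by (subst finite_measure_PiM_emb) auto
  thus "q ^ n \<le> measure (iid_sample n P) {\<lambda>i\<in>{..<n}. a}"
    using q by (simp add: power_mono)
qed

text \<open>The laws with \<open>c = 0\<close> and \<open>c = 2\<close> both produce the sample \<open>(1, \<dots>, 1)\<close> with probability above \<open>\<delta>\<close>, so the
  estimate on this sample would have to be within \<open>r < 1\<close> of both \<open>0\<close> and \<open>2\<close>.\<close>
lemma no_delta_dependent_estimator:
  assumes n: "n \<ge> 1" and L: "L \<ge> sqrt 2"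
  shows "\<not> delta_dependent_subgaussian L P2_sym n (exp (1 - 5 * L\<^sup>2 * real n)) E"
proof
  define \<delta> where "\<delta> = exp (1 - 5 * L\<^sup>2 * real n)"
  assume "delta_dependent_subgaussian L P2_sym n (exp (1 - 5 * L\<^sup>2 * real n)) E"
  hence E: "E \<in> borel_measurable (real_space n \<Otimes>\<^sub>M restrict_space borel {\<delta>..<1})"
    and sub: "\<And>P \<delta>'. P \<in> P2_sym \<Longrightarrow> \<delta>' \<in> {\<delta>..<1} \<Longrightarrow> \<P>(x in iid_sample n P.
            \<bar>E (x, \<delta>') - mean P\<bar> > L * std_dev P * sqrt ((1 + ln (1 / \<delta>')) / real n)) \<le> \<delta>'"
    by (auto simp: delta_dependent_subgaussian_def \<delta>_def)
  have L0: "L > 0" using L real_sqrt_gt_zero[of 2] by linarith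
  have "(sqrt 2)\<^sup>2 \<le> L\<^sup>2" using L by (intro power_mono) auto
  hence u: "L\<^sup>2 \<ge> 2" by simp
  have "2 * 1 \<le> L\<^sup>2 * real n" using u n by (intro mult_mono) auto
  hence \<delta>: "\<delta> \<in> {\<delta>..<1}" by (simp add: \<delta>_def)
  have "(\<lambda>x. (x, \<delta>)) \<in> measurable (real_space n) (real_space n \<Otimes>\<^sub>M restrict_space borel {\<delta>..<1})"
    by (rule measurable_Pair2') (use \<delta> in \<open>simp add: space_restrict_space\<close>)
  hence slice: "(\<lambda>x. E (x, \<delta>)) \<in> borel_measurable (real_space n)"
    by (rule measurable_compose[OF _ E])
  \<comment> \<open>The radius scales with \<open>L\<^sup>2 sqrt p\<close>, so \<open>p\<close> must be below \<open>1 / (5 L\<^sup>4)\<close> to keep it under 1.\<close>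
  define p where "p = 1 / (6 * L ^ 4)"
  have L4: "L ^ 4 = (L\<^sup>2)\<^sup>2" by (simp only: power_mult[symmetric]) simp
  have "2\<^sup>2 \<le> (L\<^sup>2)\<^sup>2" using u by (intro power_mono) auto
  hence L4': "L ^ 4 \<ge> 4" unfolding L4 by simp
  have p: "0 < p" "p \<le> 1" using L4' by (auto simp: p_def divide_le_eq)
  define r where "r = L * sqrt p * sqrt ((1 + ln (1 / \<delta>)) / real n)"
  have "(1 + ln (1 / \<delta>)) / real n = 5 * L\<^sup>2" using n by (simp add: \<delta>_def ln_div)
  hence "r = sqrt (L\<^sup>2 * p * (5 * L\<^sup>2))" using L0 by (simp add: r_def real_sqrt_mult)
  also have "L\<^sup>2 * p * (5 * L\<^sup>2) = 5 / 6"
    using L0 unfolding p_def L4 by (simp add: power2_eq_square[of "L\<^sup>2"])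
  also have "sqrt (5 / 6) < 1" by simp
  finally have r: "r < 1" .

  define x0 where "x0 = (\<lambda>i\<in>{..<n}. 1 :: real)"
  have close: "\<bar>E (x0, \<delta>) - c\<bar> \<le> r" if c: "c = 0 \<or> c = 2" for c
  proof (rule ccontr)
    assume far: "\<not> \<bar>E (x0, \<delta>) - c\<bar> \<le> r"
    let ?P = "three_point p c"
    have P: "real_distribution ?P" "?P \<in> P2_sym"
      using p by (auto intro: real_distribution_three_point three_point_in_P2_sym)
    interpret prob_space "iid_sample n ?P" by (rule prob_space_iid_sample[OF P(1)])
    have atom: "p / 2 \<le> measure ?P {1}" using p c by (intro three_point_atom) auto
    note x0 = prob_constant_sample[OF P(1) _ atom, of n, folded x0_def]
    have "(\<lambda>x. E (x, \<delta>)) \<in> borel_measurable (iid_sample n ?P)"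
      by (rule measurable_iid_sample[OF P(1) slice])
    hence "{x \<in> space (iid_sample n ?P). \<bar>E (x, \<delta>) - c\<bar> > r} \<in> events" by measurable
    hence "measure (iid_sample n ?P) {x0} \<le> \<P>(x in iid_sample n ?P. \<bar>E (x, \<delta>) - c\<bar> > r)"
      using far x0 p by (intro finite_measure_mono) auto
    also have "\<dots> \<le> \<delta>"
      using sub[OF P(2) \<delta>] p by (simp add: three_point_moments r_def)
    finally have "(p / 2) ^ n \<le> \<delta>" using x0 p by simp
    moreover have "\<delta> < (p / 2) ^ n"
    proof -
      \<comment> \<open>\<open>2 / p = 12 L\<^sup>4\<close> is below the quadratic Taylor bound of the exponential.\<close>
      have "12 * L ^ 4 < 12 * L ^ 4 + (L ^ 4 + 1) / 2" using L4' by simp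
      also have "\<dots> = 1 + (5 * L\<^sup>2 - 1) + (5 * L\<^sup>2 - 1)\<^sup>2 / 2"
      proof -
        have "12 * v\<^sup>2 + (v\<^sup>2 + 1) / 2 = 1 + (5 * v - 1) + (5 * v - 1)\<^sup>2 / 2" for v :: real
          by (simp add: power2_eq_square field_simps)
        thus ?thesis unfolding L4 .
      qed
      also have "\<dots> \<le> exp (5 * L\<^sup>2 - 1)"
        using u by (intro exp_lower_Taylor_quadratic) simp
      finally have "12 * L ^ 4 < exp (5 * L\<^sup>2 - 1)" .
      hence "inverse (exp (5 * L\<^sup>2 - 1)) < inverse (12 * L ^ 4)"
        using L0 by (intro less_imp_inverse_less) simp_all
      moreover have "p / 2 = inverse (12 * L ^ 4)" by (simp add: p_def inverse_eq_divide)
      ultimately have *: "exp (- (5 * L\<^sup>2 - 1)) < p / 2"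
        by (simp only: exp_minus[of "5 * L\<^sup>2 - 1"])
      have "\<delta> \<le> exp (real n * (- (5 * L\<^sup>2 - 1)))"
        using n by (simp add: \<delta>_def algebra_simps)
      also have "\<dots> = exp (- (5 * L\<^sup>2 - 1)) ^ n" by (rule exp_of_nat_mult)
      also have "\<dots> < (p / 2) ^ n" using * n by (intro power_strict_mono) simp_all
      finally show ?thesis .
    qed
    ultimately show False by simp
  qed
  show False using close[of 0] close[of 2] r by auto
qed

theorem theorem3p4:
  shows "(\<forall>n::nat. real n \<ge> (3 + ln 4) * 124 \<longrightarrow>
            (\<exists>E. multiple_delta_subgaussian L_star P2_1reg n (delta_min1 n) E \<and>
                 multiple_delta_subgaussian L_star P2_sym n (delta_min1 n) E))
       \<and> (\<forall>(n::nat) (L::real). n \<ge> 1 \<longrightarrow> L \<ge> sqrt 2 \<longrightarrow>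
            \<not> (\<exists>E. delta_dependent_subgaussian L P2_sym n (exp (1 - 5 * L\<^sup>2 * real n)) E))"
proof (intro conjI allI impI)
  fix n :: nat assume "real n \<ge> (3 + ln 4) * 124"
  hence E: "multiple_delta_subgaussian L_star P2_1reg n (delta_min1 n) (estimator n n)"
    by (rule estimator_subgaussian)
  moreover have "multiple_delta_subgaussian L_star P2_sym n (delta_min1 n) (estimator n n)"
    using E P2_sym_subset_P2_1reg unfolding multiple_delta_subgaussian_def by blast
  ultimately show "\<exists>E. multiple_delta_subgaussian L_star P2_1reg n (delta_min1 n) E \<and>
      multiple_delta_subgaussian L_star P2_sym n (delta_min1 n) E"
    by blast
next
  fix n :: nat and L :: real assume "n \<ge> 1" "L \<ge> sqrt 2"
  thus "\<not> (\<exists>E. delta_dependent_subgaussian L P2_sym n (exp (1 - 5 * L\<^sup>2 * real n)) E)"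
    using no_delta_dependent_estimator by blast
qed

end
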